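(* Let $k \ge 1$ and $m, n \ge 2$ be integers, and let $r_1 = m \bmod (k+1)$ and $r_2 = n \bmod (k+1)$ (remainders in $\{0,\dots,k\}$). Then $$d_k(P_m \Box P_n) \le \frac{mn - r_1 r_2}{k+1} + \min\{r_1, r_2\}.$$
   Context: $P_n$ is the path on $n$ vertices; $P_m \Box P_n$ is the Cartesian product ($m\times n$ grid): vertices $(i,j)$, $0\le i\le m-1$, $0\le j\le n-1$, with $(i,j)$ adjacent to $(i',j')$ iff ($|i-i'|=1$ and $j=j'$) or ($i=i'$ and $|j-j'|=1$). The $k$-move deduction game ($k$ a positive integer) on a finite graph $G$: a layout places a finite number of searchers on vertices of $G$ (several searchers may share a vertex). Every searcher is initially mobile. A vertex is protected once it has been occupied by some searcher (so initially occupied vertices are protected); other vertices are unprotected. The game proceeds in stages. At each stage, for every vertex $v$ that has at least one unprotected neighbour: if the number of mobile searchers on $v$ is at least the number of unprotected neighbours of $v$, then the mobile searchers on $v$ move to the unprotected neighbours of $v$ so that each unprotected neighbour receives at least one searcher; excess mobile searchers on $v$ may also move to any of these unprotected neighbours. All moves in a stage happen simultaneously, newly occupied vertices become protected, and a searcher that has moved $k$ times becomes immobile. The process repeats until all vertices are protected or no searcher can move. A layout is successful if all vertices of $G$ end up protected. The $k$-move deduction number $d_k(G)$ is the minimum number of searchers in a successful layout on $G$. *)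

theory Defs
  imports Complex_Main "Graph_Theory.Pair_Digraph"
begin

text \<open>
  An undirected simple graph is a \<^term>\<open>pair_graph\<close>: a finite, symmetric, loop-free digraph
  without parallel arcs.
\<close>

definition path_graph :: "nat \<Rightarrow> nat pair_pre_digraph" where
  "path_graph n =
     \<lparr> pverts = {..<n}, parcs = {(i, j). i < n \<and> j < n \<and> (j = Suc i \<or> i = Suc j)} \<rparr>"

definition box_product ::
    "'a pair_pre_digraph \<Rightarrow> 'b pair_pre_digraph \<Rightarrow> ('a \<times> 'b) pair_pre_digraph"
    (infixr \<open>\<box>\<close> 75) where
  "G \<box> H =
     \<lparr> pverts = pverts G \<times> pverts H,
       parcs = {((u, v), (u', v')).
                  (u, u') \<in> parcs G \<and> v = v' \<and> v \<in> pverts H \<or>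
                  u = u' \<and> u \<in> pverts G \<and> (v, v') \<in> parcs H} \<rparr>"

text \<open>
  Searchers are numbered \<open>0, \<dots>, s - 1\<close>. A state of the game records where each searcher is, how
  often it has moved, and which vertices are protected.
\<close>

record 'a game_state =
  location :: "nat \<Rightarrow> 'a"
  moves_made :: "nat \<Rightarrow> nat"
  protected :: "'a set"

definition initial_state :: "nat \<Rightarrow> (nat \<Rightarrow> 'a) \<Rightarrow> 'a game_state" where
  "initial_state s L = \<lparr> location = L, moves_made = (\<lambda>_. 0), protected = L ` {..<s} \<rparr>"

definition unprotected_nbrs :: "'a pair_pre_digraph \<Rightarrow> 'a game_state \<Rightarrow> 'a \<Rightarrow> 'a set" where
  "unprotected_nbrs G \<sigma> v = {u \<in> pverts G. (v, u) \<in> parcs G} - protected \<sigma>"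

definition mobile_on :: "nat \<Rightarrow> nat \<Rightarrow> 'a game_state \<Rightarrow> 'a \<Rightarrow> nat set" where
  "mobile_on k s \<sigma> v = {i. i < s \<and> location \<sigma> i = v \<and> moves_made \<sigma> i < k}"

definition fires :: "nat \<Rightarrow> 'a pair_pre_digraph \<Rightarrow> nat \<Rightarrow> 'a game_state \<Rightarrow> 'a \<Rightarrow> bool" where
  "fires k G s \<sigma> v \<longleftrightarrow>
     unprotected_nbrs G \<sigma> v \<noteq> {} \<and> card (unprotected_nbrs G \<sigma> v) \<le> card (mobile_on k s \<sigma> v)"

text \<open>
  One stage. Every vertex that can fire must do so, and all fire simultaneously; which mobile
  searchers on a firing vertex go where, and which excess ones stay behind, is a free choice, so a
  stage is a relation between states. A searcher never moves to the vertex it is already on, as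
  that vertex is protected; hence it has moved exactly if its location changed. When no vertex
  fires, the searchers stay put and the stage does not change the game any more.
\<close>

definition stage ::
    "nat \<Rightarrow> 'a pair_pre_digraph \<Rightarrow> nat \<Rightarrow> 'a game_state \<Rightarrow> 'a game_state \<Rightarrow> bool" where
  "stage k G s \<sigma> \<sigma>' \<longleftrightarrow>
     (\<forall>v \<in> pverts G. fires k G s \<sigma> v \<longrightarrow>
        unprotected_nbrs G \<sigma> v \<subseteq> location \<sigma>' ` mobile_on k s \<sigma> v \<and>
        location \<sigma>' ` mobile_on k s \<sigma> v \<subseteq> insert v (unprotected_nbrs G \<sigma> v)) \<and>
     (\<forall>i < s. \<not> (fires k G s \<sigma> (location \<sigma> i) \<and> moves_made \<sigma> i < k) \<longrightarrow>
        location \<sigma>' i = location \<sigma> i) \<and>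
     (\<forall>i < s. moves_made \<sigma>' i =
        (if location \<sigma>' i = location \<sigma> i then moves_made \<sigma> i else Suc (moves_made \<sigma> i))) \<and>
     protected \<sigma>' = protected \<sigma> \<union> location \<sigma>' ` {..<s}"

definition successful_layout :: "nat \<Rightarrow> 'a pair_pre_digraph \<Rightarrow> nat \<Rightarrow> (nat \<Rightarrow> 'a) \<Rightarrow> bool" where
  "successful_layout k G s L \<longleftrightarrow>
     (\<forall>i < s. L i \<in> pverts G) \<and>
     (\<exists>\<sigma>. (stage k G s)\<^sup>*\<^sup>* (initial_state s L) \<sigma> \<and> pverts G \<subseteq> protected \<sigma>)"

definition deduction_number :: "nat \<Rightarrow> 'a pair_pre_digraph \<Rightarrow> nat" where
  "deduction_number k G = (LEAST s. \<exists>L. successful_layout k G s L)"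

lemma deduction_number_attained:
  assumes "finite (pverts G)"
  shows "\<exists>L. successful_layout k G (deduction_number k G) L"
proof -
  obtain L where "bij_betw L {0..<card (pverts G)} (pverts G)"
    using ex_bij_betw_nat_finite[OF assms] by blast
  then have L: "L ` {..<card (pverts G)} = pverts G"
    by (simp add: bij_betw_def atLeast0LessThan)
  then have "successful_layout k G (card (pverts G)) L"
    unfolding successful_layout_def
    by (auto simp: initial_state_def intro!: exI[of _ "initial_state (card (pverts G)) L"])
  then have "\<exists>s L. successful_layout k G s L"
    by blast
  then show ?thesis
    unfolding deduction_number_def by (rule LeastI_ex)
qed

lemma pair_graph_path_graph: "pair_graph (path_graph n)"
proof unfold_locales
  show "finite (parcs (path_graph n))"
    by (rule finite_subset[of _ "{..<n} \<times> {..<n}"]) (auto simp: path_graph_def)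
qed (auto simp: path_graph_def symmetric_def intro!: symI)

lemma pair_graph_box_product:
  assumes "pair_graph G" "pair_graph H"
  shows "pair_graph (G \<box> H)"
proof -
  interpret G: pair_graph G by fact
  interpret H: pair_graph H by fact
  show ?thesis
  proof unfold_locales
    show fin: "finite (pverts (G \<box> H))"
      using G.pair_finite_verts H.pair_finite_verts by (simp add: box_product_def)
    show "finite (parcs (G \<box> H))"
      by (rule finite_subset[OF _ finite_cartesian_product[OF fin fin]])
        (auto simp: box_product_def dest: G.in_arcsD1 G.in_arcsD2 H.in_arcsD1 H.in_arcsD2)
    have "sym (parcs G)" "sym (parcs H)"
      using G.pair_sym_arcs H.pair_sym_arcs by (auto simp: symmetric_def)
    then show "symmetric (with_proj (G \<box> H))"
      by (auto simp: symmetric_def box_product_def intro!: symI dest: symD)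
  qed (auto simp: box_product_def dest: G.in_arcsD1 G.in_arcsD2 H.in_arcsD1 H.in_arcsD2
      G.pair_no_loops H.pair_no_loops)
qed

lemma grid_verts: "pverts (path_graph m \<box> path_graph n) = {..<m} \<times> {..<n}"
  by (simp add: path_graph_def box_product_def)

lemma grid_arcs:
  "((i, j), (i', j')) \<in> parcs (path_graph m \<box> path_graph n) \<longleftrightarrow>
     i < m \<and> i' < m \<and> j < n \<and> j' < n \<and>
     (\<bar>int i - int i'\<bar> = 1 \<and> j = j' \<or> i = i' \<and> \<bar>int j - int j'\<bar> = 1)"
  by (auto simp: path_graph_def box_product_def)

end

theory Submission
  imports Defs
begin

text \<open>
  Cut the vertex set into paths with at most \<open>k + 1\<close> vertices and put one searcher at the start of
  each. Every path should be traversed by its own searcher, since the next vertex on the path is then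
  always an unprotected neighbour. This goes on until everything is protected if the vertices can be
  ranked so that whenever a path leads from \<open>v\<close> to \<open>w\<close>, all neighbours of \<open>v\<close> other than \<open>w\<close> are
  starting vertices or have smaller rank than \<open>w\<close>. Only a searcher that has moves left at the end of
  its path could spoil this, so the short paths must advance in step and be fenced off by starting
  vertices.

  In the grid with \<open>m = q\<^sub>1 (k + 1) + r\<^sub>1\<close> and \<open>n = q\<^sub>2 (k + 1) + r\<^sub>2\<close>, the rows from \<open>r\<^sub>1\<close> on are cut into
  vertical paths and the first \<open>r\<^sub>1\<close> rows from column \<open>r\<^sub>2\<close> on into horizontal paths, all with \<open>k + 1\<close>
  vertices. The remaining \<open>r\<^sub>1 \<times> r\<^sub>2\<close> corner is covered by \<open>min r\<^sub>1 r\<^sub>2\<close> parallel paths along its longer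
  side. All neighbours of the corner lie in row \<open>r\<^sub>1\<close> or column \<open>r\<^sub>2\<close>, where paths start.
\<close>

section \<open>The game played along a path cover\<close>

locale path_cover =
  fixes k :: nat and G :: "'a pair_pre_digraph" and I :: "'i set"
    and p :: "'i \<Rightarrow> nat \<Rightarrow> 'a" and len :: "'i \<Rightarrow> nat" and rank :: "'a \<Rightarrow> nat"
  assumes finite_I: "finite I"
    and bij: "bij_betw (\<lambda>(i, t). p i t) (SIGMA i:I. {..len i}) (pverts G)"
    and len_le: "i \<in> I \<Longrightarrow> len i \<le> k"
    and arc: "i \<in> I \<Longrightarrow> t < len i \<Longrightarrow> (p i t, p i (Suc t)) \<in> parcs G"
    and rank_mono: "i \<in> I \<Longrightarrow> t < t' \<Longrightarrow> t' \<le> len i \<Longrightarrow> rank (p i t) < rank (p i t')"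
    and rank_less: "i \<in> I \<Longrightarrow> t < len i \<Longrightarrow> u \<in> pverts G \<Longrightarrow> (p i t, u) \<in> parcs G \<Longrightarrow>
      u \<noteq> p i (Suc t) \<Longrightarrow> u \<in> (\<lambda>i. p i 0) ` I \<or> rank u < rank (p i (Suc t))"
    and short: "i \<in> I \<Longrightarrow> len i < k \<Longrightarrow> t \<le> len i \<Longrightarrow> u \<in> pverts G \<Longrightarrow> (p i t, u) \<in> parcs G \<Longrightarrow>
      t < len i \<and> u = p i (Suc t) \<or> u \<in> (\<lambda>i. p i 0) ` I \<or>
      (\<exists>i' \<in> I. \<exists>t' \<le> t. len i' < k \<and> t' \<le> len i' \<and> u = p i' t')"
begin

definition searcher_path :: "nat \<Rightarrow> 'i" where
  "searcher_path = (SOME f. bij_betw f {..<card I} I)"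

lemma bij_searcher_path: "bij_betw searcher_path {..<card I} I"
  unfolding searcher_path_def
  using someI_ex[OF ex_bij_betw_nat_finite[OF finite_I]] by (simp add: atLeast0LessThan)

lemma searcher_path_in: "n < card I \<Longrightarrow> searcher_path n \<in> I"
  using bij_searcher_path by (auto simp: bij_betw_def)

lemma searcher_path_image: "searcher_path ` {..<card I} = I"
  using bij_searcher_path by (simp add: bij_betw_def)

lemma searcher_path_eq_iff: "a < card I \<Longrightarrow> b < card I \<Longrightarrow> searcher_path a = searcher_path b \<longleftrightarrow> a = b"
  using bij_searcher_path by (auto simp: bij_betw_def inj_on_def)

lemma p_eq_iff:
  assumes "i \<in> I" "j \<in> I" "t \<le> len i" "t' \<le> len j"
  shows "p i t = p j t' \<longleftrightarrow> i = j \<and> t = t'"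
  using bij_betw_imp_inj_on[OF bij] assms by (auto simp: inj_on_def)

lemma p_in: "i \<in> I \<Longrightarrow> t \<le> len i \<Longrightarrow> p i t \<in> pverts G"
  using bij_betw_imp_surj_on[OF bij] by force

lemma vertE:
  assumes "v \<in> pverts G"
  obtains i t where "i \<in> I" "t \<le> len i" "v = p i t"
  using bij_betw_imp_surj_on[OF bij] assms by force

text \<open>A searcher confined to its path has one degree of freedom, so the progress function
  \<open>\<tau>\<close> fixes its place, its move count and the protected set all at once.\<close>

definition config :: "('i \<Rightarrow> nat) \<Rightarrow> 'a game_state" where
  "config \<tau> = \<lparr> location = (\<lambda>n. p (searcher_path n) (\<tau> (searcher_path n))), moves_made = (\<lambda>n. \<tau> (searcher_path n)),
     protected = {p i t |i t. i \<in> I \<and> t \<le> \<tau> i} \<rparr>"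

text \<open>\<open>T\<close> is the number of stages played. Only paths with spare moves
  (\<open>len i < k\<close>) are tied to this clock; searchers on the others may wait.\<close>

definition valid :: "nat \<Rightarrow> ('i \<Rightarrow> nat) \<Rightarrow> bool" where
  "valid T \<tau> \<longleftrightarrow> (\<forall>i \<in> I. \<tau> i \<le> len i) \<and> (\<forall>i \<in> I. len i < k \<longrightarrow> \<tau> i = min T (len i))"

abbreviation unprot :: "('i \<Rightarrow> nat) \<Rightarrow> 'a \<Rightarrow> 'a set" where
  "unprot \<tau> \<equiv> unprotected_nbrs G (config \<tau>)"

definition fires_at :: "('i \<Rightarrow> nat) \<Rightarrow> 'i \<Rightarrow> bool" where
  "fires_at \<tau> i \<longleftrightarrow> \<tau> i < len i \<and> unprot \<tau> (p i (\<tau> i)) = {p i (Suc (\<tau> i))}"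

lemma protected_iff:
  assumes "valid T \<tau>" "i \<in> I" "t \<le> len i"
  shows "p i t \<in> protected (config \<tau>) \<longleftrightarrow> t \<le> \<tau> i"
  using assms unfolding valid_def config_def
  by simp (metis order.trans p_eq_iff)

lemma start_protected: "u \<in> (\<lambda>i. p i 0) ` I \<Longrightarrow> u \<in> protected (config \<tau>)"
  by (auto simp: config_def)

lemma next_unprotected:
  assumes "valid T \<tau>" "i \<in> I" "\<tau> i < len i"
  shows "p i (Suc (\<tau> i)) \<in> unprot \<tau> (p i (\<tau> i))"
  using assms arc[OF assms(2,3)] p_in[of i "Suc (\<tau> i)"] protected_iff[OF assms(1,2), of "Suc (\<tau> i)"]
  by (simp add: unprotected_nbrs_def)

text \<open>Apart from starts and the successor, \<open>short\<close> leaves only neighbours on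
  short paths at a position \<open>t' \<le> \<tau> i \<le> T\<close>. All short paths follow the
  same clock, so that position has been passed. Hence a searcher at the end of a short path cannot
  leave it, even with moves left.\<close>

lemma short_unprot:
  assumes "valid T \<tau>" "i \<in> I" "len i < k" "u \<in> unprot \<tau> (p i (\<tau> i))"
  shows "\<tau> i < len i \<and> u = p i (Suc (\<tau> i))"
proof (rule ccontr)
  assume *: "\<not> ?thesis"
  have t: "\<tau> i = min T (len i)" "\<tau> i \<le> len i"
    using assms by (auto simp: valid_def)
  have u: "u \<in> pverts G" "(p i (\<tau> i), u) \<in> parcs G" "u \<notin> protected (config \<tau>)"
    using assms(4) by (auto simp: unprotected_nbrs_def)
  then obtain i' t' where i': "i' \<in> I" "t' \<le> \<tau> i" "len i' < k" "t' \<le> len i'" "u = p i' t'"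
    using short[OF assms(2,3) t(2) u(1,2)] * start_protected by blast
  moreover from this have "t' \<le> \<tau> i'"
    using t assms(1) by (auto simp: valid_def)
  ultimately show False
    using u(3) protected_iff[OF assms(1)] by blast
qed

text \<open>Distinct paths share no vertex, so each searcher is alone on its vertex.\<close>

lemma mobile_on_config:
  assumes "valid T \<tau>" "n < card I"
  shows "mobile_on k (card I) (config \<tau>) (p (searcher_path n) (\<tau> (searcher_path n))) = (if \<tau> (searcher_path n) < k then {n} else {})"
proof -
  have "a = n" if "a < card I" "p (searcher_path a) (\<tau> (searcher_path a)) = p (searcher_path n) (\<tau> (searcher_path n))" for a
    using that assms p_eq_iff[of "searcher_path a" "searcher_path n" "\<tau> (searcher_path a)" "\<tau> (searcher_path n)"] searcher_path_in searcher_path_eq_iff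
    by (auto simp: valid_def)
  then show ?thesis
    using assms(2) by (auto simp: mobile_on_def config_def)
qed

text \<open>With at most one mobile searcher, firing forces exactly one unprotected neighbour. On a
  short path \<open>short_unprot\<close> identifies it. On a path of length \<open>k\<close> a
  mobile searcher is not yet at the end, and the next path vertex, being unprotected, is that
  neighbour.\<close>

lemma fires_config:
  assumes "valid T \<tau>" "n < card I"
  shows "fires k G (card I) (config \<tau>) (p (searcher_path n) (\<tau> (searcher_path n))) \<longleftrightarrow> fires_at \<tau> (searcher_path n)"
    (is "?F \<longleftrightarrow> _")
proof
  let ?i = "searcher_path n"
  let ?U = "unprot \<tau> (p ?i (\<tau> ?i))"
  assume F: ?F
  have fin: "finite ?U"
    using bij finite_I by (auto simp: unprotected_nbrs_def bij_betw_finite[symmetric])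
  from F fin have k: "\<tau> ?i < k" and "card ?U \<le> 1" "?U \<noteq> {}"
    by (auto simp: fires_def mobile_on_config[OF assms] split: if_splits)
  with fin obtain u where u: "?U = {u}"
    by (metis One_nat_def card_1_singletonE card_gt_0_iff le_antisym Suc_leI)
  have "\<tau> ?i < len ?i \<and> u = p ?i (Suc (\<tau> ?i))"
  proof (cases "len ?i < k")
    case True
    then show ?thesis
      using short_unprot[OF assms(1) searcher_path_in[OF assms(2)] True] u by auto
  next
    case False
    then show ?thesis
      using next_unprotected[OF assms(1) searcher_path_in[OF assms(2)]] u k by auto
  qed
  then show "fires_at \<tau> ?i"
    using u by (simp add: fires_at_def)
next
  assume "fires_at \<tau> (searcher_path n)"
  then show ?F
    using len_le[OF searcher_path_in[OF assms(2)]] by (auto simp: fires_def mobile_on_config[OF assms] fires_at_def)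
qed

lemma firesE:
  assumes "valid T \<tau>" "fires k G (card I) (config \<tau>) v"
  obtains n where "n < card I" "v = p (searcher_path n) (\<tau> (searcher_path n))" "fires_at \<tau> (searcher_path n)"
proof -
  \<comment> \<open>Finiteness matters because \<open>card\<close> is 0 on infinite sets; a finite
    nonempty set demands at least one mobile searcher.\<close>
  have "finite (unprot \<tau> v)"
    using bij finite_I by (auto simp: unprotected_nbrs_def bij_betw_finite[symmetric])
  then have "mobile_on k (card I) (config \<tau>) v \<noteq> {}"
    using assms(2) by (auto simp: fires_def)
  then obtain n where "n < card I" "v = p (searcher_path n) (\<tau> (searcher_path n))"
    by (auto simp: mobile_on_def config_def)
  then show thesis
    using that fires_config[OF assms(1)] assms(2) by blast
qed

section \<open>Stages and termination\<close>

definition advance :: "('i \<Rightarrow> nat) \<Rightarrow> 'i \<Rightarrow> nat" where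
  "advance \<tau> i = (if fires_at \<tau> i then Suc (\<tau> i) else \<tau> i)"

text \<open>The short paths stay on the clock: by \<open>short_unprot\<close> nothing delays their
  searchers before the end.\<close>

lemma valid_advance:
  assumes "valid T \<tau>"
  shows "valid (Suc T) (advance \<tau>)"
proof -
  have "advance \<tau> i = min (Suc T) (len i)" if i: "i \<in> I" "len i < k" for i
  proof -
    have t: "\<tau> i = min T (len i)"
      using assms i by (auto simp: valid_def)
    have "fires_at \<tau> i \<longleftrightarrow> \<tau> i < len i"
      using short_unprot[OF assms i] next_unprotected[OF assms i(1)] by (auto simp: fires_at_def)
    then show ?thesis
      using t by (auto simp: advance_def)
  qed
  moreover have "advance \<tau> i \<le> len i" if "i \<in> I" for i
    using assms that by (auto simp: advance_def fires_at_def valid_def)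
  ultimately show ?thesis
    by (simp add: valid_def)
qed

lemma stage_advance:
  assumes "valid T \<tau>"
  shows "stage k G (card I) (config \<tau>) (config (advance \<tau>))"
proof -
  let ?\<tau>' = "advance \<tau>"
  have 1: "unprot \<tau> v \<subseteq> location (config ?\<tau>') ` mobile_on k (card I) (config \<tau>) v \<and>
        location (config ?\<tau>') ` mobile_on k (card I) (config \<tau>) v \<subseteq> insert v (unprot \<tau> v)"
    if "fires k G (card I) (config \<tau>) v" for v
  proof -
    from firesE[OF assms that] obtain n where
      n: "n < card I" "v = p (searcher_path n) (\<tau> (searcher_path n))" "fires_at \<tau> (searcher_path n)" .
    then have "\<tau> (searcher_path n) < k"
      using len_le[OF searcher_path_in[OF n(1)]] by (auto simp: fires_at_def)
    then have "mobile_on k (card I) (config \<tau>) v = {n}"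
      using mobile_on_config[OF assms n(1)] n(2) by simp
    moreover have "location (config ?\<tau>') n = p (searcher_path n) (Suc (\<tau> (searcher_path n)))"
      using n(3) by (simp add: config_def advance_def)
    ultimately show ?thesis
      using n by (auto simp: fires_at_def)
  qed
  have 2: "location (config ?\<tau>') n = location (config \<tau>) n"
    if n: "n < card I" "\<not> (fires k G (card I) (config \<tau>) (location (config \<tau>) n) \<and>
      moves_made (config \<tau>) n < k)" for n
  proof -
    have "\<not> fires_at \<tau> (searcher_path n)"
    proof
      assume *: "fires_at \<tau> (searcher_path n)"
      then have "\<tau> (searcher_path n) < k"
        using len_le[OF searcher_path_in[OF n(1)]] by (auto simp: fires_at_def)
      then show False
        using n * fires_config[OF assms n(1)] by (simp add: config_def)
    qed
    then show ?thesis
      by (simp add: config_def advance_def)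
  qed
  \<comment> \<open>A move is recognised by a change of location, so consecutive path vertices must
    differ.\<close>
  have 3: "moves_made (config ?\<tau>') n = (if location (config ?\<tau>') n = location (config \<tau>) n
      then moves_made (config \<tau>) n else Suc (moves_made (config \<tau>) n))" if n: "n < card I" for n
    using p_eq_iff[OF searcher_path_in[OF n] searcher_path_in[OF n], of "Suc (\<tau> (searcher_path n))" "\<tau> (searcher_path n)"]
    by (auto simp: config_def advance_def fires_at_def)
  have "location (config ?\<tau>') ` {..<card I} = (\<lambda>i. p i (?\<tau>' i)) ` searcher_path ` {..<card I}"
    by (simp add: config_def image_image)
  then have "location (config ?\<tau>') ` {..<card I} = (\<lambda>i. p i (?\<tau>' i)) ` I"
    by (simp add: searcher_path_image)
  moreover have "{p i t |i t. i \<in> I \<and> t \<le> ?\<tau>' i} =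
      {p i t |i t. i \<in> I \<and> t \<le> \<tau> i} \<union> (\<lambda>i. p i (?\<tau>' i)) ` I"
  proof -
    \<comment> \<open>Progress grows by at most one, so no vertex is skipped.\<close>
    have "t \<le> ?\<tau>' i \<longleftrightarrow> t \<le> \<tau> i \<or> t = ?\<tau>' i" for i t
      by (auto simp: advance_def)
    then show ?thesis
      by auto
  qed
  ultimately have 4: "protected (config ?\<tau>') =
      protected (config \<tau>) \<union> location (config ?\<tau>') ` {..<card I}"
    by (simp add: config_def)
  show ?thesis
    unfolding stage_def using 1 2 3 4 by blast
qed

text \<open>The unprotected vertex of least rank is always about to be entered.\<close>

lemma progress:
  assumes "valid T \<tau>" "\<not> pverts G \<subseteq> protected (config \<tau>)"
  shows "\<exists>i \<in> I. fires_at \<tau> i"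
proof -
  let ?P = "\<lambda>v. v \<in> pverts G - protected (config \<tau>)"
  obtain v where v: "?P v" and least: "\<And>u. ?P u \<Longrightarrow> rank v \<le> rank u"
    using assms(2) ex_has_least_nat[of ?P _ rank] by blast
  from v obtain i t where i: "i \<in> I" "t \<le> len i" "v = p i t"
    using vertE by blast
  have t: "\<tau> i < t"
    using v i protected_iff[OF assms(1) i(1,2)] by auto
  with i have lt: "\<tau> i < len i" by simp
  let ?w = "p i (Suc (\<tau> i))"
  have "?w \<in> pverts G" "?w \<notin> protected (config \<tau>)"
    using p_in[OF i(1)] protected_iff[OF assms(1) i(1)] lt by auto
  then have "rank v \<le> rank ?w"
    using least by blast
  \<comment> \<open>Were \<open>v\<close> further along the path, \<open>rank_mono\<close> would
    give the unprotected \<open>?w\<close> a smaller rank.\<close>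
  then have "t = Suc (\<tau> i)"
    using rank_mono[OF i(1), of "Suc (\<tau> i)" t] t i(2,3) by (cases "t = Suc (\<tau> i)") auto
  have "unprot \<tau> (p i (\<tau> i)) \<subseteq> {?w}"
  proof
    fix u assume u: "u \<in> unprot \<tau> (p i (\<tau> i))"
    show "u \<in> {?w}"
    proof (rule ccontr)
      assume "u \<notin> {?w}"
      then have "rank u < rank v"
        using u rank_less[OF i(1) lt] start_protected i(3) \<open>t = Suc (\<tau> i)\<close>
        by (auto simp: unprotected_nbrs_def)
      then show False
        using least[of u] u by (auto simp: unprotected_nbrs_def)
    qed
  qed
  then show ?thesis
    using next_unprotected[OF assms(1) i(1) lt] lt i(1) by (auto simp: fires_at_def)
qed

text \<open>Induction on the number of unprotected vertices, which is
  \<open>sum len I - sum \<tau> I\<close>; by \<open>progress\<close> each stage lowers it.\<close>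

lemma reaches_all:
  assumes "valid T \<tau>"
  shows "\<exists>\<sigma>. (stage k G (card I))\<^sup>*\<^sup>* (config \<tau>) \<sigma> \<and> pverts G \<subseteq> protected \<sigma>"
  using assms
proof (induction "sum len I - sum \<tau> I" arbitrary: T \<tau> rule: less_induct)
  case less
  show ?case
  proof (cases "pverts G \<subseteq> protected (config \<tau>)")
    case False
    have v: "valid (Suc T) (advance \<tau>)"
      by (rule valid_advance) fact
    have "sum \<tau> I < sum (advance \<tau>) I"
      using progress[OF less.prems False] finite_I
      by (intro sum_strict_mono_ex1) (auto simp: advance_def)
    moreover have "sum (advance \<tau>) I \<le> sum len I"
      using v by (intro sum_mono) (auto simp: valid_def)
    ultimately have "sum len I - sum (advance \<tau>) I < sum len I - sum \<tau> I"
      by simp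
    from less.hyps[OF this v] stage_advance[OF less.prems] show ?thesis
      by (meson converse_rtranclp_into_rtranclp)
  qed auto
qed

theorem deduction_number_le: "deduction_number k G \<le> card I"
proof -
  have "valid 0 (\<lambda>_. 0)"
    by (simp add: valid_def)
  from reaches_all[OF this] obtain \<sigma> where
    \<sigma>: "(stage k G (card I))\<^sup>*\<^sup>* (config (\<lambda>_. 0)) \<sigma>" "pverts G \<subseteq> protected \<sigma>"
    by (elim exE conjE)
  have "(\<lambda>n. p (searcher_path n) 0) ` {..<card I} = (\<lambda>i. p i 0) ` I"
    using image_image[of "\<lambda>i. p i 0" searcher_path "{..<card I}"] by (simp add: searcher_path_image)
  then have "config (\<lambda>_. 0) = initial_state (card I) (\<lambda>n. p (searcher_path n) 0)"
    by (auto simp: config_def initial_state_def)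
  with \<sigma> have "successful_layout k G (card I) (\<lambda>n. p (searcher_path n) 0)"
    unfolding successful_layout_def using searcher_path_in p_in by auto
  then show ?thesis
    unfolding deduction_number_def by (intro Least_le) blast
qed

end

section \<open>The paths in the grid\<close>

text \<open>With \<open>a = b + c * K\<close> the bound forces \<open>c < q\<close>, so the whole
  block of length \<open>K\<close> starting at \<open>a\<close> fits below
  \<open>q * K + b\<close>.\<close>

lemma multiple_offset:
  fixes a b q K t :: nat
  assumes "b \<le> a" "K dvd a - b" "a < q * K + b" "t < K"
  shows "a + t < q * K + b" and "(a + t - b) mod K = t"
proof -
  obtain c where c: "a - b = c * K"
    using assms(2) by (metis dvd_def mult.commute)
  with assms have "c * K < q * K"
    by linarith
  then have "Suc c \<le> q"
    by simp
  then have "Suc c * K \<le> q * K"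
    by (rule mult_le_mono1)
  then show "a + t < q * K + b"
    using c assms(1,4) by simp
  have "a + t - b = c * K + t"
    using c assms(1) by simp
  then show "(a + t - b) mod K = t"
    using assms(4) by simp
qed

locale grid_cover =
  fixes k m n r1 r2 q1 q2 :: nat
  assumes k: "r1 \<le> k" "r2 \<le> k"
    and m: "m = q1 * Suc k + r1" and n: "n = q2 * Suc k + r2"
begin

text \<open>Paths are indexed by their starting vertices. The cases are the block of rows from
  \<open>r1\<close> on, the strip beside the corner, and the corner.\<close>

definition starts :: "(nat \<times> nat) set" where
  "starts = {(i, j). i < m \<and> j < n \<and>
     (if r1 \<le> i then Suc k dvd i - r1
      else if r2 \<le> j then Suc k dvd j - r2
      else if r1 \<le> r2 then j = 0 else i = 0)}"

definition vertical :: "nat \<times> nat \<Rightarrow> bool" where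
  "vertical v \<longleftrightarrow> r1 \<le> fst v \<or> snd v < r2 \<and> r2 < r1"

definition path :: "nat \<times> nat \<Rightarrow> nat \<Rightarrow> nat \<times> nat" where
  "path v t = (if vertical v then (fst v + t, snd v) else (fst v, snd v + t))"

text \<open>Lengths count steps, whence the \<open>- 1\<close>; nothing is truncated, as
  \<open>r1\<close> and \<open>r2\<close> are positive if the corner has a vertex. Since both are at
  most \<open>k\<close>, the corner paths are exactly the short ones.\<close>

definition path_len :: "nat \<times> nat \<Rightarrow> nat" where
  "path_len v = (if fst v < r1 \<and> snd v < r2 then max r1 r2 - 1 else k)"

text \<open>Together with \<open>origin\<close> this inverts \<open>path\<close>.\<close>

definition offset :: "nat \<times> nat \<Rightarrow> nat" where
  "offset v = (if r1 \<le> fst v then (fst v - r1) mod Suc k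
     else if r2 \<le> snd v then (snd v - r2) mod Suc k
     else if r1 \<le> r2 then snd v else fst v)"

definition origin :: "nat \<times> nat \<Rightarrow> nat \<times> nat" where
  "origin v = (if vertical v then (fst v - offset v, snd v) else (fst v, snd v - offset v))"

text \<open>Corner, strip and block form three layers, in this order, kept apart by multiples of
  \<open>m + n\<close>. Within a layer the rank is the coordinate along the paths, so sideways
  neighbours tie and backward ones are smaller.\<close>

definition vertex_rank :: "nat \<times> nat \<Rightarrow> nat" where
  "vertex_rank v = (if r1 \<le> fst v then 2 * (m + n) + fst v
     else if r2 \<le> snd v then (m + n) + snd v
     else if r1 \<le> r2 then snd v else fst v)"

lemma finite_starts: "finite starts"
  by (rule finite_subset[of _ "{..<m} \<times> {..<n}"]) (auto simp: starts_def)

lemma path_in: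
  assumes "v \<in> starts" "t \<le> path_len v"
  shows "path v t \<in> {..<m} \<times> {..<n}"
    and "r1 \<le> fst (path v t) \<longleftrightarrow> r1 \<le> fst v"
    and "r2 \<le> snd (path v t) \<longleftrightarrow> r2 \<le> snd v"
    and "offset (path v t) = t"
proof -
  obtain i j where v: "v = (i, j)" by (cases v)
  have 1: "i + t < m \<and> (i + t - r1) mod Suc k = t" if "r1 \<le> i"
    using that assms multiple_offset[of r1 i "Suc k" q1 t, folded m]
    by (simp add: v starts_def path_len_def)
  have 2: "j + t < n \<and> (j + t - r2) mod Suc k = t" if "i < r1" "r2 \<le> j"
    using that assms multiple_offset[of r2 j "Suc k" q2 t, folded n]
    by (simp add: v starts_def path_len_def)
  have "r1 \<le> m" "r2 \<le> n"
    by (simp_all add: m n)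
  then show "path v t \<in> {..<m} \<times> {..<n}"
    "r1 \<le> fst (path v t) \<longleftrightarrow> r1 \<le> fst v"
    "r2 \<le> snd (path v t) \<longleftrightarrow> r2 \<le> snd v"
    "offset (path v t) = t"
    using assms 1 2
    by (auto simp: v starts_def path_len_def path_def vertical_def offset_def split: if_splits)
qed

text \<open>Each region has a single direction and paths stay in their region, so the direction can
  be read off any vertex of a path.\<close>

lemma origin_path:
  assumes "v \<in> starts" "t \<le> path_len v"
  shows "origin (path v t) = v"
proof -
  have "vertical (path v t) \<longleftrightarrow> vertical v"
    using path_in(2,3)[OF assms] by (simp add: vertical_def flip: not_le)
  then show ?thesis
    using path_in(4)[OF assms] by (cases v) (auto simp: origin_def path_def)
qed

lemma origin_props:
  assumes "v \<in> {..<m} \<times> {..<n}"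
  shows "origin v \<in> starts" "offset v \<le> path_len (origin v)" "path (origin v) (offset v) = v"
proof -
  obtain i j where v: "v = (i, j)" by (cases v)
  \<comment> \<open>Rounding \<open>a\<close> down to a number congruent to \<open>b\<close> modulo
    \<open>k + 1\<close> does not go below \<open>b\<close>.\<close>
  have *: "b \<le> a - (a - b) mod Suc k \<and> Suc k dvd a - (a - b) mod Suc k - b" if "b \<le> a" for a b :: nat
  proof -
    have "a - (a - b) mod Suc k - b = (a - b) - (a - b) mod Suc k"
      by simp
    moreover have "b + (a - b) mod Suc k \<le> a"
      using that mod_less_eq_dividend[of "a - b" "Suc k"] by linarith
    ultimately show ?thesis
      by (metis dvd_minus_mod add_le_imp_le_diff)
  qed
  have le: "a mod Suc k \<le> k" for a
    using mod_less_divisor[of "Suc k" a] by simp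
  have mod_le: "(a - b) mod Suc k \<le> a" for a b :: nat
    by (meson diff_le_self mod_less_eq_dividend order.trans)
  show "origin v \<in> starts" "offset v \<le> path_len (origin v)" "path (origin v) (offset v) = v"
    using assms *[of r1 i] *[of r2 j] le mod_le
    by (auto simp: v starts_def path_len_def path_def vertical_def offset_def origin_def max_def
        split: if_splits)
qed

lemma start_path_0: "u \<in> starts \<Longrightarrow> u \<in> (\<lambda>v. path v 0) ` starts"
  by (force simp: path_def)

section \<open>The cover conditions for the grid\<close>

sublocale path_cover k "path_graph m \<box> path_graph n" starts path path_len vertex_rank
proof
  show "finite starts"
    by (rule finite_starts)
  show "bij_betw (\<lambda>(v, t). path v t) (SIGMA v:starts. {..path_len v})
      (pverts (path_graph m \<box> path_graph n))"
    unfolding grid_verts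
    by (rule bij_betw_byWitness[of _ "\<lambda>v. (origin v, offset v)"])
      (auto simp: origin_path path_in(4) origin_props dest: path_in(1))
next
  fix v assume "v \<in> starts"
  then show "path_len v \<le> k"
    using k by (auto simp: path_len_def)
next
  fix v t assume v: "v \<in> starts" "t < path_len v"
  then have "path v t \<in> {..<m} \<times> {..<n}" "path v (Suc t) \<in> {..<m} \<times> {..<n}"
    by (simp_all only: path_in(1) less_imp_le Suc_leI)
  then show "(path v t, path v (Suc t)) \<in> parcs (path_graph m \<box> path_graph n)"
    by (auto simp: path_def grid_arcs split: if_splits)
next
  fix v t t' assume v: "v \<in> starts" "t < t'" "t' \<le> path_len v"
  then show "vertex_rank (path v t) < vertex_rank (path v t')"
    using path_in(2,3)[of v t] path_in(2,3)[of v t']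
    by (auto simp: vertex_rank_def path_def vertical_def split: if_splits)
next
  fix v t u
  assume v: "v \<in> starts" "t < path_len v"
    and u: "u \<in> pverts (path_graph m \<box> path_graph n)"
      "(path v t, u) \<in> parcs (path_graph m \<box> path_graph n)" "u \<noteq> path v (Suc t)"
  obtain i j where ij: "path v t = (i, j)" by (cases "path v t")
  obtain x y where xy: "u = (x, y)" by (cases u)
  have "x < m" "y < n"
    and adj: "x = i \<and> (y = Suc j \<or> j = Suc y) \<or> y = j \<and> (x = Suc i \<or> i = Suc x)"
    using u(1,2) unfolding ij xy grid_arcs by auto
  \<comment> \<open>Row \<open>r1\<close>, and column \<open>r2\<close> in the rows before it,
    consist of starts. A neighbour that is no start therefore cannot lie in a higher layer.\<close>
  have row: "x \<noteq> r1" if "u \<notin> starts"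
    using that \<open>x < m\<close> \<open>y < n\<close> by (auto simp: xy starts_def)
  have column: "\<not> (x < r1 \<and> y = r2)" if "u \<notin> starts"
    using that \<open>x < m\<close> \<open>y < n\<close> by (auto simp: xy starts_def)
  have t: "t \<le> path_len v" "Suc t \<le> path_len v"
    using v(2) by simp_all
  have vert: "vertical v \<longleftrightarrow> vertical (path v t)"
    using path_in(2,3)[OF v(1) t(1)] by (simp add: vertical_def flip: not_le)
  then have next_eq: "path v (Suc t) = (if vertical (i, j) then (Suc i, j) else (i, Suc j))"
    using ij by (auto simp: path_def split: if_splits)
  \<comment> \<open>The successor stays in the region of \<open>(i, j)\<close>, so it ranks one
    higher in the same layer.\<close>
  have "r2 \<le> snd (path v (Suc t)) \<longleftrightarrow> r2 \<le> j"
    using path_in(3)[OF v(1) t(1)] path_in(3)[OF v(1) t(2)] ij by simp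
  moreover have "r1 \<le> fst (path v (Suc t)) \<longleftrightarrow> r1 \<le> i"
    using path_in(2)[OF v(1) t(1)] path_in(2)[OF v(1) t(2)] ij by simp
  ultimately have "u \<in> starts \<or> vertex_rank u < vertex_rank (path v (Suc t))"
    using adj u(3)[unfolded next_eq] row column \<open>x < m\<close> \<open>y < n\<close>
    unfolding next_eq by (cases "u \<in> starts") (auto simp: xy vertex_rank_def vertical_def split: if_splits)
  then show "u \<in> (\<lambda>v. path v 0) ` starts \<or> vertex_rank u < vertex_rank (path v (Suc t))"
    using start_path_0 by blast
next
  fix v t u
  assume v: "v \<in> starts" "path_len v < k" "t \<le> path_len v"
    and u: "u \<in> pverts (path_graph m \<box> path_graph n)"
      "(path v t, u) \<in> parcs (path_graph m \<box> path_graph n)"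
  obtain i j where ij: "path v t = (i, j)" by (cases "path v t")
  obtain x y where xy: "u = (x, y)" by (cases u)
  have "x < m" "y < n"
    and adj: "x = i \<and> (y = Suc j \<or> j = Suc y) \<or> y = j \<and> (x = Suc i \<or> i = Suc x)"
    using u(1,2) unfolding ij xy grid_arcs by auto
  have row: "x \<noteq> r1" if "u \<notin> starts"
    using that \<open>x < m\<close> \<open>y < n\<close> by (auto simp: xy starts_def)
  have column: "\<not> (x < r1 \<and> y = r2)" if "u \<notin> starts"
    using that \<open>x < m\<close> \<open>y < n\<close> by (auto simp: xy starts_def)
  have corner: "fst v < r1" "snd v < r2"
    using v(2) by (auto simp: path_len_def split: if_splits)
  have t: "i < r1" "j < r2" "t = (if r1 \<le> r2 then j else i)"
    using path_in(2-4)[OF v(1,3)] corner ij by (auto simp: offset_def)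
  have "path v (Suc t) = (if r1 \<le> r2 then (i, Suc j) else (Suc i, j))"
    using ij corner by (auto simp: path_def vertical_def split: if_splits)
  moreover have "path_len v = max r1 r2 - 1"
    using corner by (simp add: path_len_def)
  \<comment> \<open>The corner paths run in parallel from a common side. A corner neighbour is thus
    the successor, or has position \<open>t\<close> or \<open>t - 1\<close> on a short path.\<close>
  moreover have "path_len (origin u) < k \<and> offset u = (if r1 \<le> r2 then y else x)" if "x < r1" "y < r2"
    using that k by (auto simp: xy path_len_def origin_def offset_def vertical_def)
  ultimately have "t < path_len v \<and> u = path v (Suc t) \<or> u \<in> starts \<or>
      path_len (origin u) < k \<and> offset u \<le> t"
    using adj row column t
    by (cases "u \<in> starts") (auto simp: xy split: if_splits)
  then show "t < path_len v \<and> u = path v (Suc t) \<or> u \<in> (\<lambda>v. path v 0) ` starts \<or>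
      (\<exists>v' \<in> starts. \<exists>t' \<le> t. path_len v' < k \<and> t' \<le> path_len v' \<and> u = path v' t')"
    using start_path_0 origin_props[OF u(1)[unfolded grid_verts]]
    by (metis (no_types, lifting))
qed

section \<open>Counting the paths\<close>

lemma card_starts: "card starts \<le> q1 * n + r1 * q2 + min r1 r2"
proof -
  \<comment> \<open>These sets enumerate the starts in the block, the strip and the corner; an
    inclusion suffices for the upper bound.\<close>
  let ?A = "(\<lambda>(b, j). (r1 + b * Suc k, j)) ` ({..<q1} \<times> {..<n})"
  let ?B = "(\<lambda>(i, b). (i, r2 + b * Suc k)) ` ({..<r1} \<times> {..<q2})"
  let ?C = "if r1 \<le> r2 then {..<r1} \<times> {0} else {0} \<times> {..<r2}"
  have *: "\<exists>b. a = r + b * Suc k \<and> b < q" if "r \<le> a" "Suc k dvd a - r" "a < q * Suc k + r" for a r q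
  proof -
    obtain b where b: "a - r = b * Suc k"
      using \<open>Suc k dvd a - r\<close> by (metis dvd_def mult.commute)
    then have "b * Suc k < q * Suc k"
      using that by linarith
    then have "b < q" by (simp only: mult_less_cancel2)
    then show ?thesis
      using b that by (intro exI[of _ b]) auto
  qed
  have "starts \<subseteq> ?A \<union> ?B \<union> ?C"
  proof
    fix v assume v: "v \<in> starts"
    obtain i j where ij: "v = (i, j)" by (cases v)
    show "v \<in> ?A \<union> ?B \<union> ?C"
    proof (cases "r1 \<le> i")
      case True
      with v obtain b where "i = r1 + b * Suc k" "b < q1"
        using *[of r1 i q1, folded m] by (auto simp: starts_def ij)
      then have "v \<in> ?A"
        using v by (auto simp: starts_def ij)
      then show ?thesis by blast
    next
      case i: False
      show ?thesis
      proof (cases "r2 \<le> j")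
        case True
        with v i obtain b where "j = r2 + b * Suc k" "b < q2"
          using *[of r2 j q2, folded n] by (auto simp: starts_def ij)
        then have "v \<in> ?B"
          using v i by (auto simp: starts_def ij)
        then show ?thesis by blast
      next
        case False
        then show ?thesis
          using v i by (auto simp: starts_def ij)
      qed
    qed
  qed
  then have "card starts \<le> card (?A \<union> ?B \<union> ?C)"
    by (intro card_mono) auto
  also have "\<dots> \<le> card ?A + card ?B + card ?C"
    using card_Un_le[of ?A ?B] card_Un_le[of "?A \<union> ?B" ?C] by linarith
  also have "card ?A \<le> q1 * n"
    using card_image_le[of "{..<q1} \<times> {..<n}"] by (simp add: card_cartesian_product)
  also have "card ?B \<le> r1 * q2"
    using card_image_le[of "{..<r1} \<times> {..<q2}"] by (simp add: card_cartesian_product)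
  also have "card ?C = min r1 r2"
    by (auto simp: card_cartesian_product)
  finally show ?thesis
    by simp
qed

end

theorem theorem4p9:
  fixes k m n r1 r2 :: nat
  assumes "k \<ge> 1" and "m \<ge> 2" and "n \<ge> 2"
    and "r1 = m mod (k + 1)" and "r2 = n mod (k + 1)"
  shows "real (deduction_number k (path_graph m \<box> path_graph n))
           \<le> (real m * real n - real r1 * real r2) / (real k + 1) + real (min r1 r2)"
proof -
  define q1 q2 where "q1 = m div Suc k" and "q2 = n div Suc k"
  have m: "m = q1 * Suc k + r1" and n: "n = q2 * Suc k + r2"
    using assms(4,5) div_mult_mod_eq[of _ "Suc k"] by (simp_all only: q1_def q2_def Suc_eq_plus1)
  interpret grid_cover k m n r1 r2 q1 q2
    using assms(4,5) mod_less_divisor[of "Suc k" m] mod_less_divisor[of "Suc k" n] m n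
    by unfold_locales simp_all
  have "deduction_number k (path_graph m \<box> path_graph n) \<le> q1 * n + r1 * q2 + min r1 r2"
    using deduction_number_le card_starts by (rule order.trans)
  then have "real (deduction_number k (path_graph m \<box> path_graph n))
      \<le> real (q1 * n + r1 * q2 + min r1 r2)"
    by (simp only: of_nat_le_iff)
  also have "\<dots> = real q1 * real n + real r1 * real q2 + real (min r1 r2)"
    by simp
  \<comment> \<open>This is \<open>m * n - r1 * r2 = (m - r1) * n + r1 * (n - r2)\<close> divided by
    \<open>k + 1\<close>.\<close>
  also have "real q1 * real n + real r1 * real q2
      = (real m * real n - real r1 * real r2) / (real k + 1)"
  proof -
    have "real m = real q1 * (real k + 1) + real r1" "real n = real q2 * (real k + 1) + real r2"
      using arg_cong[OF m, of real] arg_cong[OF n, of real] by (simp_all add: algebra_simps)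
    then show ?thesis
      by (simp add: field_simps)
  qed
  finally show ?thesis .
qed

end
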